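(* For every integer $q\ge1$, $$\log 2\,\sum_{l=1}^{q}\sum_{k\ge2}\frac{(-1)^k}{k\log\left(k2^l\right)}+q(\log 2)^2\sum_{k\ge2}\frac{1}{k\log(2k)\log\left(k2^{q+1}\right)}=\sum_{l=1}^{q}\frac{1}{l+1}.$$
   Context: Here $\log$ is the natural logarithm, and the infinite sums are over integers $k\ge 2$, taken as limits of partial sums. *)

theory Defs
  imports Complex_Main
begin

end

theory Submission
  imports Defs
begin

text \<open>Put \<open>a l k = 1 / (k ln (k 2^l))\<close>. Everything rests on the doubling relation
  \<open>2 a l (2 k) = a (l + 1) k\<close>: writing an alternating sum as twice its even part minus
  the full sum, it gives
  \[ \sum_{k=2}^{2N+1} (-1)^k a_l(k) = \sum_{k=1}^{N} a_{l+1}(k) - \sum_{k=2}^{2N+1} a_l(k). \]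
  Although \<open>\<Sum>k. a l k\<close> diverges, its block from \<open>N + 1\<close> to \<open>2 N + 1\<close> is at most
  \<open>1 / ln (N + 1)\<close>, so both full sums may be cut off at the same index. In the limit
  (\<open>gap_sums\<close>)
  \[ \sum_{k\ge2} (-1)^k a_l(k) = a_{l+1}(1) - \sum_{k\ge2} (a_l(k) - a_{l+1}(k)). \]
  The alternating series converges by Leibniz' criterion, and this in turn yields
  the convergence of the series on the right. Summing over \<open>l\<close>, the differences
  telescope to \<open>a 1 k - a (q + 1) k = q ln 2 / (k ln (2 k) ln (k 2^(q + 1)))\<close>, while
  \<open>ln 2 * a (l + 1) 1 = 1 / (l + 1)\<close> produces the right-hand side.\<close>

definition a :: "nat \<Rightarrow> nat \<Rightarrow> real" where
  "a l k = 1 / (real k * ln (real k * 2 ^ l))"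

lemma ln_shift: "k \<ge> 1 \<Longrightarrow> ln (real k * 2 ^ l) = ln (real k) + real l * ln 2"
  by (simp add: ln_mult ln_realpow)

lemma a_doubling: "k \<ge> 1 \<Longrightarrow> 2 * a l (2 * k) = a (Suc l) k"
  unfolding a_def by (simp add: mult_ac)

lemma a_antimono:
  assumes "2 \<le> m" "m \<le> n"
  shows "a l n \<le> a l m"
proof -
  have "0 < ln (real m) + real l * ln 2" "0 < ln (real n) + real l * ln 2"
    using assms by (auto intro!: add_pos_nonneg)
  then show ?thesis
    using assms by (auto simp: a_def ln_shift intro!: divide_left_mono mult_mono mult_pos_pos)
qed

lemma a_nonneg: "2 \<le> k \<Longrightarrow> 0 \<le> a l k"
  unfolding a_def by (simp add: ln_shift)

lemma a_le: "2 \<le> k \<Longrightarrow> a l k \<le> 1 / (real k * ln (real k))"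
  unfolding a_def
  by (intro divide_left_mono mult_left_mono mult_pos_pos) (auto simp: ln_shift intro!: add_pos_nonneg)

lemma inverse_ln_tendsto_0: "(\<lambda>n. 1 / ln (real (n + 2))) \<longlonglongrightarrow> 0"
proof -
  have "filterlim (\<lambda>n. real (n + 2)) at_top sequentially"
    by (rule filterlim_compose[OF filterlim_real_sequentially filterlim_add_const_nat_at_top])
  then have "filterlim (\<lambda>n. ln (real (n + 2))) at_top sequentially"
    by (rule filterlim_compose[OF ln_at_top])
  then show ?thesis
    by (intro real_tendsto_divide_at_top[OF tendsto_const])
qed

text \<open>A block of the divergent series whose length is comparable to its starting index:
  \<open>n + 2\<close> terms, each at most \<open>1 / ((n + 2) ln (n + 2))\<close>.\<close>
lemma block_tendsto_0: "(\<lambda>n. \<Sum>k = n..<2 * n + 2. a l (k + 2)) \<longlonglongrightarrow> 0"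
proof (rule tendsto_sandwich[OF _ _ tendsto_const inverse_ln_tendsto_0])
  show "\<forall>\<^sub>F n in sequentially. 0 \<le> (\<Sum>k = n..<2 * n + 2. a l (k + 2))"
    by (intro always_eventually allI sum_nonneg a_nonneg) auto
  have "(\<Sum>k = n..<2 * n + 2. a l (k + 2)) \<le> 1 / ln (real (n + 2))" for n
  proof -
    have "(\<Sum>k = n..<2 * n + 2. a l (k + 2)) \<le> (\<Sum>k = n..<2 * n + 2. a l (n + 2))"
      by (intro sum_mono a_antimono) auto
    also have "\<dots> = real (n + 2) * a l (n + 2)"
      by simp
    also have "\<dots> \<le> real (n + 2) * (1 / (real (n + 2) * ln (real (n + 2))))"
      by (intro mult_left_mono a_le) auto
    also have "\<dots> = 1 / ln (real (n + 2))"
      by simp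
    finally show ?thesis .
  qed
  then show "\<forall>\<^sub>F n in sequentially. (\<Sum>k = n..<2 * n + 2. a l (k + 2)) \<le> 1 / ln (real (n + 2))"
    by simp
qed

lemma alternating_summable: "summable (\<lambda>k. (-1) ^ k * a l (k + 2))"
proof (rule summable_Leibniz(1))
  show "(\<lambda>k. a l (k + 2)) \<longlonglongrightarrow> 0"
  proof (rule tendsto_sandwich[OF _ _ tendsto_const inverse_ln_tendsto_0])
    show "\<forall>\<^sub>F k in sequentially. 0 \<le> a l (k + 2)"
      by (simp add: a_nonneg)
    have "a l (k + 2) \<le> 1 / ln (real (k + 2))" for k
    proof -
      have "a l (k + 2) \<le> 1 / (real (k + 2) * ln (real (k + 2)))"
        by (rule a_le) simp
      also have "\<dots> \<le> 1 / (1 * ln (real (k + 2)))"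
        by (intro divide_left_mono mult_right_mono mult_pos_pos) auto
      finally show ?thesis by simp
    qed
    then show "\<forall>\<^sub>F k in sequentially. a l (k + 2) \<le> 1 / ln (real (k + 2))"
      by simp
  qed
  show "monoseq (\<lambda>k. a l (k + 2))"
    by (intro monoI2) (auto intro: a_antimono)
qed

text \<open>By \<open>a_doubling\<close>, twice the even part is a sum of \<open>a (Suc l)\<close> starting at index 1, and
  its first term stands alone. The cut-off \<open>2 * n + 2\<close> makes the remaining \<open>n\<close> terms pair
  exactly with the first \<open>n\<close> terms of the full sum, leaving one block.\<close>
lemma alternating_partial_sum:
  "(\<Sum>k<2 * n + 2. (-1) ^ k * a l (k + 2)) =
     a (Suc l) 1 - (\<Sum>k<n. a l (k + 2) - a (Suc l) (k + 2)) - (\<Sum>k = n..<2 * n + 2. a l (k + 2))"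
proof -
  have "(\<Sum>k<2 * n. (-1) ^ k * a l (k + 2)) =
      (\<Sum>k<n. a (Suc l) (k + 1)) - (\<Sum>k<2 * n. a l (k + 2))" for n
  proof (induction n)
    case (Suc n)
    have "2 * a l (2 * n + 2) = a (Suc l) (n + 1)"
      using a_doubling[of "n + 1" l] by simp
    with Suc show ?case by (simp add: algebra_simps)
  qed simp
  from this[of "Suc n"]
  have "(\<Sum>k<2 * n + 2. (-1) ^ k * a l (k + 2)) =
      (\<Sum>k<Suc n. a (Suc l) (k + 1)) - (\<Sum>k<2 * n + 2. a l (k + 2))"
    by (simp only: mult_Suc_right add.commute[of 2])
  also have "(\<Sum>k<Suc n. a (Suc l) (k + 1)) = a (Suc l) 1 + (\<Sum>k<n. a (Suc l) (k + 2))"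
    by (subst sum.lessThan_Suc_shift) simp
  also have "(\<Sum>k<2 * n + 2. a l (k + 2)) =
      (\<Sum>k<n. a l (k + 2)) + (\<Sum>k = n..<2 * n + 2. a l (k + 2))"
    using sum.atLeastLessThan_concat[of 0 n "2 * n + 2" "\<lambda>k. a l (k + 2)"]
    by (simp add: lessThan_atLeast0)
  finally show ?thesis by (simp add: sum_subtractf)
qed

text \<open>The value of the alternating series is already a limit, so passing to the limit in
  \<open>alternating_partial_sum\<close> proves convergence of the gap series along with its value.\<close>
lemma gap_sums:
  "(\<lambda>k. a l (k + 2) - a (Suc l) (k + 2)) sums
     (a (Suc l) 1 - (\<Sum>k. (-1) ^ k * a l (k + 2)))"
proof -
  have "(\<lambda>n. \<Sum>k<n. (-1) ^ k * a l (k + 2)) \<longlonglongrightarrow> (\<Sum>k. (-1) ^ k * a l (k + 2))"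
    using alternating_summable by (rule summable_LIMSEQ)
  moreover have "filterlim (\<lambda>n::nat. 2 * n + 2) sequentially sequentially"
    by (rule filterlim_subseq) (auto simp: strict_mono_def)
  ultimately have "(\<lambda>n. \<Sum>k<2 * n + 2. (-1) ^ k * a l (k + 2)) \<longlonglongrightarrow>
      (\<Sum>k. (-1) ^ k * a l (k + 2))"
    by (rule filterlim_compose)
  then have "(\<lambda>n. a (Suc l) 1 - (\<Sum>k<2 * n + 2. (-1) ^ k * a l (k + 2))
        - (\<Sum>k = n..<2 * n + 2. a l (k + 2))) \<longlonglongrightarrow>
      a (Suc l) 1 - (\<Sum>k. (-1) ^ k * a l (k + 2)) - 0"
    by (intro tendsto_diff tendsto_const block_tendsto_0)
  then show ?thesis
    unfolding alternating_partial_sum sums_def by simp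
qed

lemma telescoped_gap:
  assumes "2 \<le> k"
  shows "(\<Sum>l = 1..q. a l k - a (Suc l) k) =
    real q * ln 2 * (1 / (real k * ln (2 * real k) * ln (real k * 2 ^ (q + 1))))"
proof -
  have "(\<Sum>l = 1..q. a l k - a (Suc l) k) = a 1 k - a (q + 1) k"
    by (induction q) auto
  also have "\<dots> = real q * ln 2 * (1 / (real k * ln (real k * 2 ^ 1) * ln (real k * 2 ^ (q + 1))))"
  proof -
    let ?x = "ln (real k * 2 ^ 1)" and ?y = "ln (real k * 2 ^ (q + 1))"
    have logs: "?x = ln (real k) + real 1 * ln 2" "?y = ln (real k) + real (q + 1) * ln 2"
      using assms by (simp_all only: ln_shift)
    then have pos: "?x > 0" "?y > 0"
      using assms by (simp_all only:) (auto intro!: add_pos_nonneg)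
    have "1 / (c * x) - 1 / (c * y) = (y - x) * (1 / (c * x * y))"
      if "c > 0" "x > 0" "y > 0" for c x y :: real
      using that by (simp add: field_simps)
    from this[of "real k", OF _ pos] have "a 1 k - a (q + 1) k = (?y - ?x) * (1 / (real k * ?x * ?y))"
      using assms unfolding a_def by simp
    also have "?y - ?x = real q * ln 2"
      unfolding logs by (simp add: algebra_simps)
    finally show ?thesis .
  qed
  finally show ?thesis by (simp add: mult.commute)
qed

(* The sums over k \<ge> 2 are written with k + 2, k ranging over all natural numbers. *)
theorem mainTheorem2:
  fixes q :: nat
  assumes "q \<ge> 1"
  shows "(\<forall>l\<in>{1..q}. summable (\<lambda>k. (-1) ^ (k + 2) / (real (k + 2) * ln (real (k + 2) * 2 ^ l))))
    \<and> summable (\<lambda>k. 1 / (real (k + 2) * ln (2 * real (k + 2)) * ln (real (k + 2) * 2 ^ (q + 1))))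
    \<and> ln 2 * (\<Sum>l = 1..q. \<Sum>k. (-1) ^ (k + 2) / (real (k + 2) * ln (real (k + 2) * 2 ^ l)))
        + real q * (ln 2)\<^sup>2
            * (\<Sum>k. 1 / (real (k + 2) * ln (2 * real (k + 2)) * ln (real (k + 2) * 2 ^ (q + 1))))
      = (\<Sum>l = 1..q. 1 / (real l + 1))"
proof -
  let ?g = "\<lambda>k. 1 / (real (k + 2) * ln (2 * real (k + 2)) * ln (real (k + 2) * 2 ^ (q + 1)))"
  let ?S = "\<lambda>l. \<Sum>k. (-1) ^ k * a l (k + 2)"
  have alt: "(-1) ^ (k + 2) / (real (k + 2) * ln (real (k + 2) * 2 ^ l)) = (-1) ^ k * a l (k + 2)"
    for k l
    unfolding a_def by simp
  have "(\<lambda>k. \<Sum>l = 1..q. a l (k + 2) - a (Suc l) (k + 2)) sums (\<Sum>l = 1..q. a (Suc l) 1 - ?S l)"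
    by (intro sums_sum gap_sums)
  then have g: "(\<lambda>k. real q * ln 2 * ?g k) sums (\<Sum>l = 1..q. a (Suc l) 1 - ?S l)"
    by (subst (asm) telescoped_gap) auto
  have "real q * ln 2 \<noteq> 0"
    using assms by simp
  with sums_summable[OF g] have summable_g: "summable ?g"
    by (simp only: summable_cmult_iff) simp
  have "ln 2 * a (Suc l) 1 = 1 / (real l + 1)" for l
    unfolding a_def ln_shift[OF order_refl] by (simp add: add.commute)
  then have "(\<Sum>l = 1..q. 1 / (real l + 1)) = ln 2 * (\<Sum>l = 1..q. a (Suc l) 1)"
    by (simp only: sum_distrib_left)
  also have "\<dots> = ln 2 * (\<Sum>l = 1..q. ?S l) + ln 2 * (\<Sum>l = 1..q. a (Suc l) 1 - ?S l)"
    by (simp add: sum_subtractf algebra_simps)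
  also have "(\<Sum>l = 1..q. a (Suc l) 1 - ?S l) = real q * ln 2 * (\<Sum>k. ?g k)"
    using sums_unique[OF g] suminf_mult[OF summable_g, of "real q * ln 2"] by (simp only:)
  finally have "ln 2 * (\<Sum>l = 1..q. ?S l) + real q * (ln 2)\<^sup>2 * (\<Sum>k. ?g k) =
      (\<Sum>l = 1..q. 1 / (real l + 1))"
    by (simp add: power2_eq_square mult_ac)
  with summable_g show ?thesis
    unfolding alt using alternating_summable by blast
qed

end
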